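(* Let $(\varphi,\psi)$ be a tame pair of endomorphisms of a torsion-free nilpotent group of finite Prüfer rank. If the Reidemeister coincidence zeta function $R_{\varphi,\psi}(z)$ is rational, then for every $n\in\mathbb{N}$ the Gauss congruence $$\sum_{k\mid n}\mu(n/k)\,R(\varphi^k,\psi^k)\equiv0\mod n$$ holds, where $\mu$ is the Möbius function.
   Context: For endomorphisms $\varphi,\psi$ of a group $G$, elements $\alpha,\beta\in G$ are $(\varphi,\psi)$-conjugate if $\beta=\psi(g)\,\alpha\,\varphi(g^{-1})$ for some $g\in G$; the Reidemeister coincidence number $R(\varphi,\psi)$ is the number of $(\varphi,\psi)$-conjugacy classes. The pair is tame if $R(\varphi^n,\psi^n)<\infty$ for all $n\in\mathbb{N}=\{1,2,\dots\}$. For a tame pair the Reidemeister coincidence zeta function is $R_{\varphi,\psi}(z)=\exp\left(\sum_{k=1}^\infty\frac{R(\varphi^k,\psi^k)}{k}z^k\right)$. A group has finite Prüfer rank if there is an $r$ such that every finitely generated subgroup can be generated by at most $r$ elements. *)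

theory Defs
  imports
    "HOL-Algebra.Generated_Groups"
    "HOL-Computational_Algebra.Polynomial_FPS"
    "HOL-Computational_Algebra.Squarefree"
    "HOL-Number_Theory.Cong"
begin

definition torsion_free_group :: "('a, 'b) monoid_scheme \<Rightarrow> bool" where
  "torsion_free_group G \<longleftrightarrow> group G \<and>
     (\<forall>x\<in>carrier G. \<forall>n::nat. n > 0 \<longrightarrow> x [^]\<^bsub>G\<^esub> n = \<one>\<^bsub>G\<^esub> \<longrightarrow> x = \<one>\<^bsub>G\<^esub>)"

definition commutator_subgroup :: "('a, 'b) monoid_scheme \<Rightarrow> 'a set \<Rightarrow> 'a set \<Rightarrow> 'a set" where
  "commutator_subgroup G H K = generate G
     (\<Union>x\<in>H. \<Union>y\<in>K. {x \<otimes>\<^bsub>G\<^esub> y \<otimes>\<^bsub>G\<^esub> inv\<^bsub>G\<^esub> x \<otimes>\<^bsub>G\<^esub> inv\<^bsub>G\<^esub> y})"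

primrec lower_central :: "('a, 'b) monoid_scheme \<Rightarrow> nat \<Rightarrow> 'a set" where
  "lower_central G 0 = carrier G"
| "lower_central G (Suc i) = commutator_subgroup G (lower_central G i) (carrier G)"

definition nilpotent_group :: "('a, 'b) monoid_scheme \<Rightarrow> bool" where
  "nilpotent_group G \<longleftrightarrow> group G \<and> (\<exists>c. lower_central G c = {\<one>\<^bsub>G\<^esub>})"

definition finite_pruefer_rank :: "('a, 'b) monoid_scheme \<Rightarrow> bool" where
  "finite_pruefer_rank G \<longleftrightarrow>
     (\<exists>r::nat. \<forall>H. subgroup H G \<and> (\<exists>S\<subseteq>carrier G. finite S \<and> H = generate G S) \<longrightarrow>
        (\<exists>T\<subseteq>carrier G. finite T \<and> card T \<le> r \<and> H = generate G T))"

definition coincidence_conj ::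
    "('a, 'b) monoid_scheme \<Rightarrow> ('a \<Rightarrow> 'a) \<Rightarrow> ('a \<Rightarrow> 'a) \<Rightarrow> ('a \<times> 'a) set" where
  "coincidence_conj G \<phi> \<psi> = {(\<alpha>, \<beta>). \<alpha> \<in> carrier G \<and> \<beta> \<in> carrier G \<and>
     (\<exists>g\<in>carrier G. \<beta> = \<psi> g \<otimes>\<^bsub>G\<^esub> \<alpha> \<otimes>\<^bsub>G\<^esub> \<phi> (inv\<^bsub>G\<^esub> g))}"

definition reidemeister_classes ::
    "('a, 'b) monoid_scheme \<Rightarrow> ('a \<Rightarrow> 'a) \<Rightarrow> ('a \<Rightarrow> 'a) \<Rightarrow> 'a set set" where
  "reidemeister_classes G \<phi> \<psi> = carrier G // coincidence_conj G \<phi> \<psi>"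

(* As card is 0 on infinite sets, this is the coincidence number only when there are
   finitely many classes; for tame pairs this holds for all iterates with exponent >= 1. *)
definition reidemeister_number ::
    "('a, 'b) monoid_scheme \<Rightarrow> ('a \<Rightarrow> 'a) \<Rightarrow> ('a \<Rightarrow> 'a) \<Rightarrow> nat" where
  "reidemeister_number G \<phi> \<psi> = card (reidemeister_classes G \<phi> \<psi>)"

definition tame_pair :: "('a, 'b) monoid_scheme \<Rightarrow> ('a \<Rightarrow> 'a) \<Rightarrow> ('a \<Rightarrow> 'a) \<Rightarrow> bool" where
  "tame_pair G \<phi> \<psi> \<longleftrightarrow> (\<forall>n\<ge>1. finite (reidemeister_classes G (\<phi> ^^ n) (\<psi> ^^ n)))"

(* The zeta function as a formal power series: exp composed with a series whose constant
   coefficient is 0 (the coefficient formula gives 0 at k = 0, since x / 0 = 0). *)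
definition reidemeister_zeta ::
    "('a, 'b) monoid_scheme \<Rightarrow> ('a \<Rightarrow> 'a) \<Rightarrow> ('a \<Rightarrow> 'a) \<Rightarrow> complex fps" where
  "reidemeister_zeta G \<phi> \<psi> = fps_compose (fps_exp 1)
     (Abs_fps (\<lambda>k. of_nat (reidemeister_number G (\<phi> ^^ k) (\<psi> ^^ k)) / of_nat k))"

(* f = p / q; cross-multiplied, since fps division by a series with zero constant
   coefficient need not be the quotient in the field of fractions. *)
definition rational_fps :: "'a::field fps \<Rightarrow> bool" where
  "rational_fps f \<longleftrightarrow> (\<exists>p q. q \<noteq> 0 \<and> fps_of_poly q * f = fps_of_poly p)"

definition moebius_mu :: "nat \<Rightarrow> int" where
  "moebius_mu n = (if squarefree n then (-1) ^ card (prime_factors n) else 0)"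

end

theory Submission
  imports Defs "HOL-Computational_Algebra.Polynomial_Factorial"
begin

text \<open>
Put \<open>a k = R(\<phi>^k, \<psi>^k)\<close> and \<open>f = exp (\<Sum>k\<ge>1. a k / k * X^k)\<close>. The congruences come out of two
properties of this sequence: the \<open>a k\<close> are integers, and \<open>f\<close> is rational. There are two independent
steps.

First, \<open>f\<close> has integer coefficients (\<open>rational_fps_integral_of_log_deriv\<close>). The recursion
\<open>X f' = A f\<close> with \<open>A = \<Sum>k\<ge>1. a k * X^k\<close> shows that its coefficients are rational, so \<open>f = P / Q\<close> with
coprime integer polynomials \<open>P\<close> and \<open>Q\<close> (\<open>rational_fps_descent\<close>). Every irreducible nonconstant factor
\<open>r\<close> of \<open>P\<close> or \<open>Q\<close> is a factor of the denominator of \<open>A = X f' / f\<close>, because logarithmic derivatives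
have a pole at each zero and each pole of \<open>f\<close>. But \<open>A\<close> has integer coefficients, so by the argument
of Fatou's lemma \<open>r\<close> has constant coefficient \<open>\<plusminus>1\<close> (\<open>prime_factor_unit_constant_coeff\<close>). In other words,
\<open>a k\<close> is a difference of power sums of algebraic integers. It follows that \<open>Q\<close> may be taken with
constant coefficient \<open>\<plusminus>1\<close>, and \<open>P / Q\<close> has integer coefficients.

Second, an integer power series with constant coefficient \<open>1\<close> is a product of Euler factors
\<open>(1 - X^d)^(-b d)\<close> with integer exponents \<open>b d\<close> (\<open>log_deriv_strip_euler_factors\<close>). Logarithmic
derivatives turn this into \<open>a k = (\<Sum>d dvd k. d * b d)\<close>, and Moebius inversion gives
\<open>(\<Sum>k dvd n. \<mu>(n/k) * a k) = n * b n\<close> (\<open>gauss_congruence_of_log_deriv\<close>).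
\<close>

unbundle fps_syntax

section \<open>Moebius inversion\<close>

lemma moebius_mu_prime_mult:
  assumes "prime p" "\<not> p dvd d" "d > 0"
  shows "moebius_mu (p * d) = - moebius_mu d"
proof -
  have cop: "coprime p d"
    using assms by (simp add: prime_imp_coprime)
  have sqf: "squarefree (p * d) \<longleftrightarrow> squarefree d"
    using squarefree_mult_coprime[OF cop squarefree_prime[OF assms(1)]]
      squarefree_multD(2)[of p d] by blast
  have "prime_factors (p * d) = insert p (prime_factors d)"
    using assms by (subst prime_factors_product) (auto simp: prime_prime_factors)
  moreover have "p \<notin> prime_factors d"
    using assms(2) by (auto dest: in_prime_factors_imp_dvd)
  ultimately have "card (prime_factors (p * d)) = Suc (card (prime_factors d))"
    by simp
  with sqf show ?thesis
    by (simp add: moebius_mu_def)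
qed

text \<open>Only squarefree divisors contribute. For a fixed prime \<open>p\<close> dividing \<open>n\<close>, multiplication by \<open>p\<close>
matches the squarefree divisors prime to \<open>p\<close> with those divisible by \<open>p\<close>, and it changes the
sign of \<open>\<mu>\<close>; so the two halves of the sum cancel.\<close>

lemma sum_moebius_mu_divisors:
  assumes "n > 0"
  shows "(\<Sum>d | d dvd n. moebius_mu d) = (if n = 1 then 1 else 0)"
proof (cases "n = 1")
  case True
  then show ?thesis
    by (simp add: moebius_mu_def)
next
  case False
  then obtain p where p: "prime p" "p dvd n"
    by (meson prime_factor_nat)
  have p0: "p > 0"
    using p(1) by (simp add: prime_gt_0_nat)
  have fin: "finite {d. d dvd n}"
    using assms by simp
  let ?D = "{d. d dvd n \<and> squarefree d}"
  let ?A = "{d \<in> ?D. \<not> p dvd d}" and ?B = "{d \<in> ?D. p dvd d}"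
  have bij: "bij_betw (\<lambda>d. p * d) ?A ?B"
  proof (rule bij_betwI[where g = "\<lambda>d. d div p"])
    show "(\<lambda>d. p * d) \<in> ?A \<rightarrow> ?B"
    proof
      fix d assume d: "d \<in> ?A"
      then have cop: "coprime p d"
        using p(1) by (simp add: prime_imp_coprime)
      then have "p * d dvd n"
        using d p(2) by (simp add: divides_mult)
      moreover have "squarefree (p * d)"
        using squarefree_mult_coprime[OF cop squarefree_prime[OF p(1)]] d by simp
      ultimately show "p * d \<in> ?B"
        by simp
    qed
    show "(\<lambda>d. d div p) \<in> ?B \<rightarrow> ?A"
    proof
      fix d assume d: "d \<in> ?B"
      then obtain e where e: "d = p * e"
        by blast
      have "\<not> p dvd e"
      proof
        assume "p dvd e"
        then have "p ^ 2 dvd d"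
          unfolding e by (simp add: power2_eq_square)
        then show False
          using d squarefreeD[of d p] p(1) by auto
      qed
      moreover have "squarefree e" "e dvd n"
        using d e squarefree_multD(2)[of p e] by (auto intro: dvd_mult_right)
      ultimately show "d div p \<in> ?A"
        using e p0 by simp
    qed
  qed (use p0 in auto)
  have "(\<Sum>d | d dvd n. moebius_mu d) = (\<Sum>d\<in>?D. moebius_mu d)"
    using fin by (intro sum.mono_neutral_right) (auto simp: moebius_mu_def)
  also have "?D = ?A \<union> ?B"
    by blast
  also have "(\<Sum>d\<in>?A \<union> ?B. moebius_mu d) = (\<Sum>d\<in>?A. moebius_mu d) + (\<Sum>d\<in>?B. moebius_mu d)"
    using fin by (intro sum.union_disjoint) auto
  also have "(\<Sum>d\<in>?B. moebius_mu d) = (\<Sum>d\<in>?A. moebius_mu (p * d))"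
    by (rule sum.reindex_bij_betw[OF bij, symmetric])
  also have "\<dots> = (\<Sum>d\<in>?A. - moebius_mu d)"
    using p(1) assms by (intro sum.cong refl moebius_mu_prime_mult) (auto intro: dvd_pos_nat)
  finally show ?thesis
    using False by (simp add: sum_negf)
qed

text \<open>After exchanging the summations, \<open>c d\<close> is multiplied by the sum of \<open>\<mu>\<close> over the divisors of
\<open>n div d\<close>, which is \<open>0\<close> unless \<open>d = n\<close>.\<close>

lemma moebius_inversion_divisor_sum:
  fixes a c :: "nat \<Rightarrow> int"
  assumes n: "n > 0" and a: "\<And>k. k dvd n \<Longrightarrow> a k = (\<Sum>d | d dvd k. c d)"
  shows "(\<Sum>k | k dvd n. moebius_mu (n div k) * a k) = c n"
proof -
  have fin: "finite {d. d dvd n}"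
    using n by simp
  have "(\<Sum>k | k dvd n. moebius_mu (n div k) * a k) =
        (\<Sum>k | k dvd n. \<Sum>d | d dvd n \<and> d dvd k. moebius_mu (n div k) * c d)"
  proof (intro sum.cong refl)
    fix k assume k: "k \<in> {k. k dvd n}"
    then have "{d. d dvd n \<and> d dvd k} = {d. d dvd k}"
      by (auto intro: dvd_trans)
    then show "moebius_mu (n div k) * a k = (\<Sum>d | d dvd n \<and> d dvd k. moebius_mu (n div k) * c d)"
      using a k by (simp add: sum_distrib_left)
  qed
  also have "\<dots> = (\<Sum>d | d dvd n. \<Sum>k | k dvd n \<and> d dvd k. moebius_mu (n div k) * c d)"
    using sum.swap_restrict[OF fin fin, of "\<lambda>k d. moebius_mu (n div k) * c d" "\<lambda>k d. d dvd k"]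
    by simp
  also have "\<dots> = (\<Sum>d | d dvd n. c d * (\<Sum>e | e dvd n div d. moebius_mu e))"
  proof (intro sum.cong refl)
    fix d assume "d \<in> {d. d dvd n}"
    then obtain m where m: "n = d * m"
      by blast
    have pos: "d > 0" "m > 0"
      using n m by auto
    have "bij_betw (\<lambda>k. n div k) {k. k dvd n \<and> d dvd k} {e. e dvd n div d}"
    proof (rule bij_betwI[where g = "\<lambda>e. n div e"])
      show "(\<lambda>k. n div k) \<in> {k. k dvd n \<and> d dvd k} \<rightarrow> {e. e dvd n div d}"
      proof
        fix k assume "k \<in> {k. k dvd n \<and> d dvd k}"
        then obtain l t where "n = k * t" "k = d * l"
          by (auto elim!: dvdE)
        then show "n div k \<in> {e. e dvd n div d}"
          using n by (auto simp: mult.assoc)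
      qed
      show "(\<lambda>e. n div e) \<in> {e. e dvd n div d} \<rightarrow> {k. k dvd n \<and> d dvd k}"
      proof
        fix e assume "e \<in> {e. e dvd n div d}"
        then obtain t where "m = e * t"
          using m pos by (auto elim!: dvdE)
        then have "n = e * (d * t)" "e > 0"
          using m pos by (auto simp: mult_ac)
        then show "n div e \<in> {k. k dvd n \<and> d dvd k}"
          by (metis dvd_triv_left dvd_triv_right mem_Collect_eq nonzero_mult_div_cancel_left
              less_numeral_extra(3))
      qed
      show "n div (n div k) = k" if "k \<in> {k. k dvd n \<and> d dvd k}" for k
        using that n by auto
      show "n div (n div e) = e" if "e \<in> {e. e dvd n div d}" for e
      proof -
        have "e dvd n"
          using that m pos by (auto intro: dvd_mult)
        then show ?thesis
          using n by auto
      qed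
    qed
    then have "(\<Sum>k | k dvd n \<and> d dvd k. moebius_mu (n div k)) = (\<Sum>e | e dvd n div d. moebius_mu e)"
      by (rule sum.reindex_bij_betw)
    then show "(\<Sum>k | k dvd n \<and> d dvd k. moebius_mu (n div k) * c d) =
               c d * (\<Sum>e | e dvd n div d. moebius_mu e)"
      unfolding sum_distrib_right[symmetric] by simp
  qed
  also have "\<dots> = (\<Sum>d | d dvd n. if d = n then c d else 0)"
  proof (intro sum.cong refl)
    fix d assume d: "d \<in> {d. d dvd n}"
    then have "n div d > 0" "n div d = 1 \<longleftrightarrow> d = n"
      using n by (auto elim!: dvdE)
    then show "c d * (\<Sum>e | e dvd n div d. moebius_mu e) = (if d = n then c d else 0)"
      by (simp add: sum_moebius_mu_divisors)
  qed
  also have "\<dots> = c n"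
    using fin by simp
  finally show ?thesis .
qed

section \<open>Euler factors and the Gauss congruences\<close>

text \<open>The relation \<open>A = X f' / f\<close>, cross-multiplied because power series over a ring need not be
invertible. For \<open>f = exp (\<Sum>k\<ge>1. a k / k * X^k)\<close> it says that \<open>A = \<Sum>k\<ge>1. a k * X^k\<close>.\<close>

definition log_deriv :: "'a::comm_ring_1 fps \<Rightarrow> 'a fps \<Rightarrow> bool" where
  "log_deriv A f \<longleftrightarrow> fps_X * fps_deriv f = A * f"

lemma log_deriv_mult:
  assumes "log_deriv A f" "log_deriv B g"
  shows "log_deriv (A + B) (f * g)"
proof -
  have "fps_X * fps_deriv (f * g) = f * (fps_X * fps_deriv g) + (fps_X * fps_deriv f) * g"
    by (simp add: algebra_simps)
  also have "\<dots> = (A + B) * (f * g)"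
    using assms unfolding log_deriv_def by (simp only:) (simp add: algebra_simps)
  finally show ?thesis
    by (simp add: log_deriv_def)
qed

lemma log_deriv_power:
  assumes "log_deriv A f"
  shows "log_deriv (of_nat n * A) (f ^ n)"
proof (induction n)
  case 0
  show ?case by (simp add: log_deriv_def)
next
  case (Suc n)
  then show ?case
    using log_deriv_mult[OF assms Suc] by (simp add: algebra_simps)
qed

text \<open>The series \<open>m X^m / (1 - X^m)\<close>, which is the logarithmic derivative of the Euler factor
\<open>1 / (1 - X^m)\<close>.\<close>

definition multiples_series :: "nat \<Rightarrow> int fps" where
  "multiples_series m = Abs_fps (\<lambda>k. if k > 0 \<and> m dvd k then int m else 0)"

text \<open>The witness is \<open>(1 - X^m)^(-b)\<close>. It is written as a power of \<open>1 - X^m\<close> or of the geometric series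
\<open>E\<close>, according to the sign of \<open>b\<close>, so that it visibly has integer coefficients.\<close>

lemma exists_log_deriv_multiples_series:
  assumes m: "m > 0"
  shows "\<exists>h. h $ 0 = 1 \<and> log_deriv (of_int b * multiples_series m) h"
proof -
  define u :: "int fps" where "u = 1 - fps_X ^ m"
  define E :: "int fps" where "E = Abs_fps (\<lambda>k. if m dvd k then 1 else 0)"
  have Eu: "E * u = 1"
  proof (rule fps_ext)
    fix k
    have "m dvd k - m \<longleftrightarrow> m dvd k" if "\<not> k < m"
      using that by (simp add: dvd_minus_self)
    moreover have "m dvd k \<longleftrightarrow> k = 0" if "k < m"
      using that by (auto dest: dvd_imp_le)
    ultimately have "(E - fps_X ^ m * E) $ k = (1 :: int fps) $ k"
      using m by (simp add: E_def fps_X_power_mult_nth)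
    then show "(E * u) $ k = (1 :: int fps) $ k"
      by (simp add: u_def algebra_simps)
  qed
  have S: "multiples_series m = of_nat m * (E - 1)"
    by (rule fps_ext) (simp add: multiples_series_def E_def fps_of_nat[symmetric])
  have Su: "multiples_series m * u = of_nat m * fps_X ^ m"
  proof -
    have "multiples_series m * u = of_nat m * (E * u - u)"
      by (simp add: S algebra_simps)
    then show ?thesis
      by (simp add: Eu) (simp add: u_def)
  qed
  have "fps_X * fps_deriv u = - of_nat m * fps_X ^ m"
    using m by (intro fps_ext) (auto simp: u_def fps_of_nat[symmetric])
  then have u: "log_deriv (- multiples_series m) u"
    using Su by (simp add: log_deriv_def)
  have E: "log_deriv (multiples_series m) E"
  proof -
    have "E * fps_deriv u + fps_deriv E * u = 0"
      using arg_cong[OF Eu, of fps_deriv] by simp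
    then have "fps_X * (E * (E * fps_deriv u + fps_deriv E * u)) = 0"
      by simp
    then have "E * E * (fps_X * fps_deriv u) + (E * u) * (fps_X * fps_deriv E) = 0"
      by (simp add: algebra_simps)
    then have "E * E * (- multiples_series m * u) + fps_X * fps_deriv E = 0"
      using u by (simp add: Eu log_deriv_def)
    moreover have "E * E * (- multiples_series m * u) = - multiples_series m * E * (E * u)"
      by (simp add: mult_ac)
    ultimately show ?thesis
      by (simp add: Eu log_deriv_def)
  qed
  have u0: "u $ 0 = 1" "E $ 0 = 1"
    using m by (simp_all add: u_def E_def)
  show ?thesis
  proof (cases "b \<ge> 0")
    case True
    then show ?thesis
      using log_deriv_power[OF E, of "nat b"] u0
      by (intro exI[of _ "E ^ nat b"]) (simp add: fps_power_zeroth)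
  next
    case False
    then show ?thesis
      using log_deriv_power[OF u, of "nat (- b)"] u0
      by (intro exI[of _ "u ^ nat (- b)"]) (simp add: fps_power_zeroth)
  qed
qed

text \<open>An integer series with constant coefficient \<open>1\<close> is a product of Euler factors \<open>(1 - X^d)^(-b d)\<close>; this splits
off those with \<open>d \<le> N\<close> and leaves \<open>g\<close>. The point is that the exponents are integers: if the
logarithmic derivative \<open>B\<close> of \<open>g\<close> vanishes up to degree \<open>N\<close>, then its next coefficient is \<open>N + 1\<close>
times the integer \<open>g $ (N + 1)\<close>, and this integer is the next exponent.\<close>

lemma log_deriv_strip_euler_factors:
  fixes f :: "int fps"
  assumes "f $ 0 = 1" "log_deriv A f"
  shows "\<exists>b g B. g $ 0 = 1 \<and> log_deriv B g \<and> (\<forall>k\<in>{1..N}. B $ k = 0) \<and>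
    (\<forall>k>0. A $ k = (\<Sum>d | d dvd k \<and> d \<le> N. int d * b d) + B $ k)"
proof (induction N)
  case 0
  show ?case
    using assms by (intro exI[of _ "\<lambda>_. 0"] exI[of _ f] exI[of _ A]) simp
next
  case (Suc N)
  then obtain b g B where g0: "g $ 0 = 1" and gB: "log_deriv B g"
    and B0: "\<And>k. k \<in> {1..N} \<Longrightarrow> B $ k = 0"
    and A: "\<And>k. k > 0 \<Longrightarrow> A $ k = (\<Sum>d | d dvd k \<and> d \<le> N. int d * b d) + B $ k"
    by blast
  define M where "M = Suc N"
  have nth: "(fps_X * fps_deriv g) $ n = (\<Sum>i=0..n. B $ i * g $ (n - i))" for n
    using gB by (simp add: log_deriv_def fps_mult_nth)
  have "B $ 0 = 0"
    using nth[of 0] g0 by simp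
  then have B0': "B $ k = 0" if "k \<le> N" for k
    using that B0[of k] by (cases k) auto
  \<comment> \<open>Only the term with \<open>B $ M\<close> survives in the
    coefficient of degree \<open>M\<close> of \<open>X g' = B g\<close>.\<close>
  have "int M * g $ M = (\<Sum>i=0..M. B $ i * g $ (M - i))"
    using nth[of M] by (simp add: M_def)
  also have "\<dots> = (\<Sum>i\<in>{M}. B $ i * g $ (M - i))"
    by (rule sum.mono_neutral_right) (auto simp: M_def B0')
  finally have BM: "B $ M = int M * g $ M"
    using g0 by simp
  obtain h where h0: "h $ 0 = 1" and h: "log_deriv (of_int (- g $ M) * multiples_series M) h"
    using exists_log_deriv_multiples_series[of M "- g $ M"] by (auto simp: M_def)
  define b' where "b' = b(M := g $ M)"
  define B' where "B' = B + of_int (- g $ M) * multiples_series M"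
  have B': "B' $ k = B $ k - (if M dvd k then int M * g $ M else 0)" if "k > 0" for k
    using that by (simp add: B'_def multiples_series_def fps_of_int[symmetric])
  show ?case
  proof (intro exI conjI ballI allI impI)
    show "(g * h) $ 0 = 1"
      using g0 h0 by simp
    show "log_deriv B' (g * h)"
      unfolding B'_def by (rule log_deriv_mult[OF gB h])
  next
    fix k assume k: "k \<in> {1..Suc N}"
    show "B' $ k = 0"
    proof (cases "k = M")
      case True
      then show ?thesis
        using k BM by (simp add: B')
    next
      case False
      then have "k < M"
        using k by (simp add: M_def)
      then have "\<not> M dvd k"
        using k by (auto dest: dvd_imp_le)
      then show ?thesis
        using k \<open>k < M\<close> B0'[of k] by (simp add: B' M_def)
    qed
  next
    fix k :: nat assume k: "k > 0"
    have "{d. d dvd k \<and> d \<le> Suc N} =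
          (if M dvd k then insert M {d. d dvd k \<and> d \<le> N} else {d. d dvd k \<and> d \<le> N})"
      by (auto simp: M_def le_Suc_eq)
    moreover have "(\<Sum>d | d dvd k \<and> d \<le> N. int d * b' d) = (\<Sum>d | d dvd k \<and> d \<le> N. int d * b d)"
      by (intro sum.cong) (auto simp: b'_def M_def)
    moreover have "M \<notin> {d. d dvd k \<and> d \<le> N}" "finite {d. d dvd k \<and> d \<le> N}"
      using k by (auto simp: M_def)
    ultimately show "A $ k = (\<Sum>d | d dvd k \<and> d \<le> Suc N. int d * b' d) + B' $ k"
      using A[OF k] B'[OF k] by (simp add: b'_def)
  qed
qed

text \<open>Integrality of \<open>f\<close> makes \<open>A $ k\<close> the sum of \<open>d * b d\<close> over the divisors \<open>d\<close> of \<open>k\<close>, with integers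
\<open>b d\<close>; so the Moebius sum is \<open>n * b n\<close>.\<close>

theorem gauss_congruence_of_log_deriv:
  fixes f :: "int fps"
  assumes "f $ 0 = 1" "log_deriv A f" "n > 0"
  shows "[(\<Sum>k | k dvd n. moebius_mu (n div k) * A $ k) = 0] (mod int n)"
proof -
  obtain b and B :: "int fps" where B: "\<And>k. k \<in> {1..n} \<Longrightarrow> B $ k = 0"
    and A: "\<And>k. k > 0 \<Longrightarrow> A $ k = (\<Sum>d | d dvd k \<and> d \<le> n. int d * b d) + B $ k"
    using log_deriv_strip_euler_factors[OF assms(1,2), of n] by blast
  have "A $ k = (\<Sum>d | d dvd k. int d * b d)" if "k dvd n" for k
  proof -
    have k: "0 < k" "k \<le> n"
      using that assms(3) by (auto dest: dvd_imp_le intro: dvd_pos_nat)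
    then have "{d. d dvd k \<and> d \<le> n} = {d. d dvd k}"
      by (auto intro: order_trans[OF dvd_imp_le])
    then show ?thesis
      using A[of k] B[of k] k by simp
  qed
  then have "(\<Sum>k | k dvd n. moebius_mu (n div k) * A $ k) = int n * b n"
    by (intro moebius_inversion_divisor_sum assms(3))
  then show ?thesis
    by (simp add: cong_0_iff)
qed

section \<open>Constant coefficients and integral logarithmic derivatives\<close>

text \<open>The Gauss lemma for power series: look at the product of the first coefficients of \<open>F\<close> and of \<open>H\<close>
that \<open>p\<close> does not divide.\<close>

lemma prime_dvd_fps_mult_nth:
  fixes F H :: "int fps"
  assumes "prime p" and FH: "\<And>n. p dvd (F * H) $ n" and F: "\<not> p dvd F $ k"
  shows "p dvd H $ n"
proof (rule ccontr)
  assume H: "\<not> p dvd H $ n"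
  define i where "i = (LEAST i. \<not> p dvd F $ i)"
  define j where "j = (LEAST j. \<not> p dvd H $ j)"
  have i: "\<not> p dvd F $ i" "\<And>i'. i' < i \<Longrightarrow> p dvd F $ i'"
    unfolding i_def using LeastI[of "\<lambda>i. \<not> p dvd F $ i", OF F] not_less_Least by blast+
  have j: "\<not> p dvd H $ j" "\<And>j'. j' < j \<Longrightarrow> p dvd H $ j'"
    unfolding j_def using LeastI[of "\<lambda>j. \<not> p dvd H $ j", OF H] not_less_Least by blast+
  have "p dvd (\<Sum>l\<in>{0..i + j} - {i}. F $ l * H $ (i + j - l))"
  proof (rule dvd_sum)
    fix l assume "l \<in> {0..i + j} - {i}"
    then have "l < i \<or> i + j - l < j"
      by auto
    then show "p dvd F $ l * H $ (i + j - l)"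
      using i(2) j(2) by (auto intro: dvd_mult dvd_mult2)
  qed
  moreover have "(F * H) $ (i + j) = F $ i * H $ j + (\<Sum>l\<in>{0..i + j} - {i}. F $ l * H $ (i + j - l))"
    unfolding fps_mult_nth by (subst sum.remove[of _ i]) auto
  ultimately have "p dvd F $ i * H $ j"
    using FH[of "i + j"] by (simp add: dvd_add_left_iff)
  then show False
    using i(1) j(1) \<open>prime p\<close> by (simp add: prime_dvd_mult_iff)
qed

text \<open>By the Gauss lemma the prime factors of \<open>c\<close> can be cancelled from \<open>H\<close> one at a time, until \<open>F\<close> is
seen to divide a unit.\<close>

lemma primitive_fps_dvd_const_imp_unit:
  fixes F :: "int fps"
  assumes prim: "\<And>p. prime p \<Longrightarrow> \<exists>n. \<not> p dvd F $ n"
    and "F * H = fps_const c" "c \<noteq> 0"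
  shows "is_unit (F $ 0)"
  using assms(2,3)
proof (induction c arbitrary: H rule: prime_divisors_induct)
  case zero
  then show ?case by simp
next
  case (unit c)
  then have "F $ 0 * H $ 0 = c"
    by (metis fps_mult_nth_0 fps_nth_fps_const)
  then show ?case
    using unit(1) by (metis dvd_mult_left)
next
  case (factor p c)
  obtain k where k: "\<not> p dvd F $ k"
    using prim[OF factor(1)] by blast
  have "p dvd (F * H) $ n" for n
    unfolding factor(3) by simp
  then have H: "p dvd H $ n" for n
    using prime_dvd_fps_mult_nth[OF factor(1) _ k] by blast
  define H' where "H' = Abs_fps (\<lambda>n. H $ n div p)"
  have "H = fps_const p * H'"
    using H by (intro fps_ext) (simp add: H'_def)
  then have "fps_const p * (F * H') = fps_const p * fps_const c"
    using factor(3) by (simp add: mult_ac)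
  moreover have "fps_const p \<noteq> 0"
    using factor(1) by auto
  ultimately have "F * H' = fps_const c"
    by (metis mult_left_cancel)
  then show ?case
    using factor.IH factor.prems(2) by auto
qed

lemma primitive_poly_dvd_const_imp_unit:
  fixes r :: "int poly"
  assumes "content r = 1" "fps_of_poly r * H = fps_const c" "c \<noteq> 0"
  shows "is_unit (coeff r 0)"
proof -
  have "\<exists>n. \<not> p dvd fps_of_poly r $ n" if "prime p" for p
  proof (rule ccontr)
    assume "\<not> ?thesis"
    then have "[:p:] dvd r"
      by (simp add: const_poly_dvd_iff)
    then have "p dvd 1"
      using assms(1) const_poly_dvd_iff_dvd_content[of p r] by simp
    then show False
      using that by auto
  qed
  from primitive_fps_dvd_const_imp_unit[OF this assms(2,3)] show ?thesis
    by simp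
qed

text \<open>The coefficient ring need not be a field, so the greatest common divisor \<open>1\<close> of \<open>r\<close> and \<open>t\<close> is a
combination of them only up to a constant. Take a nonzero combination \<open>g\<close> of minimal degree.
Pseudo-division shows that \<open>g\<close> divides constant multiples of \<open>r\<close> and of \<open>t\<close>; as \<open>r\<close> is prime and
does not divide \<open>t\<close>, this forces \<open>g\<close> to be constant.\<close>

lemma bezout_const_of_prime_elem:
  fixes r t :: "'a::factorial_ring_gcd poly"
  assumes r: "prime_elem r" and deg: "degree r > 0" and ndvd: "\<not> r dvd t"
  shows "\<exists>x y c. c \<noteq> 0 \<and> x * r + y * t = [:c:]"
proof -
  define I where "I = {g. g \<noteq> 0 \<and> (\<exists>x y. g = x * r + y * t)}"
  have "r \<in> I"
  proof -
    have "r = 1 * r + 0 * t"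
      by simp
    then show ?thesis
      using r unfolding I_def prime_elem_def by blast
  qed
  then obtain g where g: "g \<in> I" and min: "\<And>h. h \<in> I \<Longrightarrow> degree g \<le> degree h"
    using ex_has_least_nat[of "\<lambda>g. g \<in> I" r degree] by blast
  then obtain x y where xy: "g = x * r + y * t" and g0: "g \<noteq> 0"
    by (auto simp: I_def)
  have division: "\<exists>a q. a \<noteq> 0 \<and> smult a h = g * q" if h: "h = u * r + v * t" for h u v
  proof -
    obtain a q where aq: "a \<noteq> 0" "smult a h = g * q + pseudo_mod h g"
      using pseudo_mod(1)[OF g0] by blast
    have "pseudo_mod h g = smult a h - g * q"
      using aq(2) by simp
    also have "\<dots> = (smult a u - q * x) * r + (smult a v - q * y) * t"
      unfolding h xy by (simp add: algebra_simps smult_add_right)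
    finally have "pseudo_mod h g \<in> I" if "pseudo_mod h g \<noteq> 0"
      using that unfolding I_def by blast
    then have "pseudo_mod h g = 0"
      using pseudo_mod(2)[OF g0, of h] min[of "pseudo_mod h g"] by (meson leD)
    then show ?thesis
      using aq by auto
  qed
  have ndvd_const: "\<not> r dvd [:c:]" if "c \<noteq> 0" for c
    using that deg by (auto dest: dvd_imp_degree_le)
  obtain a q where aq: "a \<noteq> 0" "smult a r = g * q"
    using division[of r 1 0] by auto
  obtain b s where bs: "b \<noteq> 0" "smult b t = g * s"
    using division[of t 0 1] by auto
  have "\<not> r dvd g"
  proof
    assume "r dvd g"
    then have "r dvd [:b:] * t"
      using bs(2) by simp
    then show False
      using r ndvd ndvd_const[OF bs(1)] by (simp only: prime_elem_dvd_mult_iff) simp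
  qed
  moreover have "r dvd g * q"
    using aq(2) by (metis dvd_smult dvd_refl)
  ultimately have "r dvd q"
    using r by (simp add: prime_elem_dvd_mult_iff)
  then obtain q' where "q = r * q'"
    by blast
  then have "r * [:a:] = r * (g * q')"
    using aq(2) by (simp add: mult_ac)
  then have "g * q' = [:a:]"
    using r by (metis mult_left_cancel prime_elem_def)
  then have "degree g + degree q' = 0"
    using aq(1) by (metis degree_mult_eq degree_pCons_0 mult_eq_0_iff pCons_eq_0_iff)
  then obtain c where "g = [:c:]"
    by (metis add_is_0 degree_eq_zeroE)
  then show ?thesis
    using xy g0 by (metis pCons_0_0)
qed

text \<open>The assumption \<open>eq\<close> says that \<open>A\<close> is the logarithmic derivative of \<open>P / Q\<close>. Since a logarithmic
derivative has simple poles only, each root of \<open>r\<close> is a pole of \<open>A\<close>, and \<open>A\<close> has integer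
coefficients. This is Fatou's lemma on rational power series over the integers, in the case needed
here. Write \<open>P = r^(m+1) S\<close> and cancel \<open>r^m\<close>: then \<open>r\<close> divides, among the integer power series, a
polynomial \<open>t\<close> that it does not divide as a polynomial. By Bezout it then divides a nonzero
constant, which is possible for a primitive polynomial only if its constant coefficient is a unit.\<close>

lemma prime_factor_unit_constant_coeff:
  fixes P Q r :: "int poly" and A :: "int fps"
  assumes eq: "fps_X * fps_of_poly (pderiv P * Q - P * pderiv Q) = A * fps_of_poly (P * Q)"
    and cop: "coprime P Q" and P0: "coeff P 0 \<noteq> 0"
    and r: "prime_elem r" "degree r > 0" "r dvd P"
  shows "is_unit (coeff r 0)"
proof -
  have "P \<noteq> 0"
    using P0 by auto
  have "\<not> is_unit r"
    using r(1) by (simp add: prime_elem_def)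
  obtain S where S: "P = r ^ multiplicity r P * S" "\<not> r dvd S"
    using multiplicity_decompose'[OF \<open>P \<noteq> 0\<close> \<open>\<not> is_unit r\<close>] by blast
  have "multiplicity r P > 0"
    using r(3) \<open>P \<noteq> 0\<close> \<open>\<not> is_unit r\<close> by (simp add: multiplicity_gt_zero_iff)
  then obtain m where m: "multiplicity r P = Suc m"
    using gr0_implies_Suc by blast
  have P: "P = r ^ Suc m * S"
    using S(1) m by metis
  define t where "t = [:0, 1:] * (of_nat (Suc m) * pderiv r * S * Q)"
  define w where "w = pderiv S * Q - S * pderiv Q"
  have dP: "pderiv P = r ^ m * r * pderiv S + S * (of_nat (Suc m) * r ^ m * pderiv r)"
    unfolding P by (simp only: pderiv_mult pderiv_power_Suc) (simp add: of_nat_poly mult_ac)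
  have "x * ((R * r * S' + S * (k * R * r')) * Q - (R * r * S) * Q') =
      R * (x * (k * r' * S * Q) + x * r * (S' * Q - S * Q'))" for x R S' k r' Q' :: "int poly"
    by (simp add: algebra_simps)
  from this[of "[:0, 1:]" "r ^ m" "pderiv S" "of_nat (Suc m)" "pderiv r" "pderiv Q", folded dP t_def w_def]
  have "[:0, 1:] * (pderiv P * Q - P * pderiv Q) = r ^ m * (t + [:0, 1:] * r * w)"
    unfolding P by (simp only: power_Suc2)
  from arg_cong[OF this, of fps_of_poly]
  have "fps_of_poly (r ^ m) * fps_of_poly (t + [:0, 1:] * r * w) = A * fps_of_poly (P * Q)"
    using eq by (simp only: fps_of_poly_mult fps_of_poly_fps_X)
  also have "\<dots> = fps_of_poly (r ^ m) * (A * fps_of_poly (r * S * Q))"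
    unfolding P by (simp only: fps_of_poly_mult power_Suc mult_ac)
  finally have "fps_of_poly (r ^ m) * fps_of_poly (t + [:0, 1:] * r * w) =
      fps_of_poly (r ^ m) * (A * fps_of_poly (r * S * Q))" .
  moreover have "fps_of_poly (r ^ m) \<noteq> 0"
    using r(1) fps_of_poly_eq_iff[of "r ^ m" 0] by (simp add: prime_elem_def)
  ultimately have "fps_of_poly (t + [:0, 1:] * r * w) = A * fps_of_poly (r * S * Q)"
    by (metis mult_left_cancel)
  then have t: "fps_of_poly t = fps_of_poly r * (A * fps_of_poly (S * Q) - fps_X * fps_of_poly w)"
    by (simp only: fps_of_poly_mult fps_of_poly_add fps_of_poly_fps_X) (simp add: algebra_simps)
  \<comment> \<open>The factors of \<open>t\<close> are treated one by one.
    If \<open>r\<close> divided \<open>X\<close>, it would be \<open>\<plusminus>X\<close>, against \<open>coeff P 0 \<noteq> 0\<close>.\<close>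
  have "\<not> r dvd [:0, 1:]"
  proof
    assume "r dvd [:0, 1:]"
    then obtain s where s: "[:0, 1:] = r * s"
      by blast
    have "coeff r 0 \<noteq> 0"
      using r(3) P0 by (auto simp: coeff_mult elim!: dvdE)
    moreover have "coeff r 0 * coeff s 0 = 0"
      using arg_cong[OF s, of "\<lambda>p. coeff p 0"] by (simp add: coeff_mult)
    ultimately have "coeff s 0 = 0"
      by simp
    have "s \<noteq> 0"
      using s by auto
    then have "degree r + degree s = 1"
      using arg_cong[OF s, of degree] r(1) by (simp add: degree_mult_eq prime_elem_def)
    then have "degree s = 0"
      using r(2) by simp
    then show False
      using \<open>coeff s 0 = 0\<close> \<open>s \<noteq> 0\<close> by (metis degree_eq_zeroE coeff_pCons_0 pCons_0_0)
  qed
  moreover have "\<not> r dvd of_nat (Suc m)"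
    using r(2) by (auto simp: of_nat_poly dest: dvd_imp_degree_le)
  moreover have "\<not> r dvd pderiv r"
  proof
    assume "r dvd pderiv r"
    moreover have "pderiv r \<noteq> 0"
      using r(2) by (simp add: pderiv_eq_0_iff)
    ultimately have "degree r \<le> degree (pderiv r)"
      by (rule dvd_imp_degree_le)
    then show False
      using r(2) by (simp add: degree_pderiv)
  qed
  moreover have "\<not> r dvd Q"
    using cop r(3) \<open>\<not> is_unit r\<close> by (meson coprime_common_divisor)
  ultimately have "\<not> r dvd t"
    unfolding t_def using S(2) by (simp only: prime_elem_dvd_mult_iff[OF r(1)]) simp
  then obtain x y c where c: "c \<noteq> 0" "x * r + y * t = [:c:]"
    using bezout_const_of_prime_elem[OF r(1,2)] by blast
  have "fps_of_poly r * (fps_of_poly x + fps_of_poly y *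
      (A * fps_of_poly (S * Q) - fps_X * fps_of_poly w)) = fps_of_poly (x * r + y * t)"
    unfolding fps_of_poly_add fps_of_poly_mult[of x] fps_of_poly_mult[of y] t
    by (simp add: algebra_simps)
  then have "fps_of_poly r * (fps_of_poly x + fps_of_poly y *
      (A * fps_of_poly (S * Q) - fps_X * fps_of_poly w)) = fps_const c"
    by (simp add: c(2) fps_of_poly_const)
  moreover have "content r = 1"
    using r(1,2) by (metis less_numeral_extra(3) nonconst_poly_irreducible_iff prime_elem_imp_irreducible)
  ultimately show ?thesis
    using primitive_poly_dvd_const_imp_unit c(1) by blast
qed

text \<open>Both sides are multiplicative in \<open>P\<close> up to sign, so it suffices to look at prime factors: for a
constant prime there is nothing to do, and a prime of positive degree has constant coefficient \<open>\<plusminus>1\<close>.\<close>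

lemma constant_coeff_dvd_content:
  fixes P Q :: "int poly" and A :: "int fps"
  assumes eq: "fps_X * fps_of_poly (pderiv P * Q - P * pderiv Q) = A * fps_of_poly (P * Q)"
    and cop: "coprime P Q" and P0: "coeff P 0 \<noteq> 0"
  shows "coeff P 0 dvd content P"
proof -
  have "coeff D 0 dvd content D" if "D dvd P" for D
    using that
  proof (induction D rule: prime_divisors_induct)
    case zero
    then show ?case by simp
  next
    case (unit D)
    then show ?case
      by (auto elim!: is_unit_polyE)
  next
    case (factor r D)
    have r: "r dvd P" "D dvd P"
      using factor.prems by (auto dest: dvd_mult_left dvd_mult_right)
    have "coeff r 0 dvd content r"
    proof (cases "degree r > 0")
      case True
      then have "is_unit (coeff r 0)"
        using prime_factor_unit_constant_coeff[OF eq cop P0 _ _ r(1)] factor(1) by simp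
      then show ?thesis
        by (rule unit_imp_dvd)
    next
      case False
      then show ?thesis
        by (auto elim!: degree_eq_zeroE)
    qed
    then show ?case
      using factor.IH r(2) by (simp add: coeff_mult content_mult mult_dvd_mono)
  qed
  then show ?thesis
    by simp
qed

section \<open>Descent of rationality to integer polynomials\<close>

definition complex_fps :: "int fps \<Rightarrow> complex fps" where
  "complex_fps F = Abs_fps (\<lambda>n. of_int (F $ n))"

lemma complex_fps_nth [simp]: "complex_fps F $ n = of_int (F $ n)"
  by (simp add: complex_fps_def)

lemma complex_fps_inject: "complex_fps F = complex_fps H \<longleftrightarrow> F = H"
  by (simp add: fps_eq_iff)

lemma complex_fps_mult: "complex_fps (F * H) = complex_fps F * complex_fps H"
  by (rule fps_ext) (simp add: fps_mult_nth)

lemma complex_fps_diff: "complex_fps (F - H) = complex_fps F - complex_fps H"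
  by (rule fps_ext) simp

lemma complex_fps_deriv: "complex_fps (fps_deriv F) = fps_deriv (complex_fps F)"
  by (rule fps_ext) simp

lemma complex_fps_X: "complex_fps fps_X = fps_X"
  by (rule fps_ext) simp

text \<open>Such a functional turns a linear relation with complex coefficients between rational numbers into
one with rational coefficients.\<close>

lemma exists_rat_linear_functional:
  assumes "(z::complex) \<noteq> 0"
  shows "\<exists>L. L z = (1::rat) \<and> (\<forall>x y. L (x + y) = L x + L y) \<and> (\<forall>r x. L (of_rat r * x) = r * L x)"
proof -
  interpret vector_space_pair "\<lambda>(r::rat) (x::complex). of_rat r * x" "(*) :: rat \<Rightarrow> rat \<Rightarrow> rat"
    by unfold_locales (auto simp: algebra_simps of_rat_add of_rat_mult)
  have "vs1.independent {z}"
    using assms by simp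
  from linear_independent_extend[OF this, of "\<lambda>_. 1"]
  obtain L where L: "Vector_Spaces.linear (\<lambda>(r::rat) (x::complex). of_rat r * x) (*) L" "L z = 1"
    by auto
  interpret L: Vector_Spaces.linear "\<lambda>(r::rat) (x::complex). of_rat r * x" "(*) :: rat \<Rightarrow> rat \<Rightarrow> rat" L
    by (rule L(1))
  show ?thesis
    using L(2) L.add L.scale by blast
qed

lemma common_denominator:
  assumes "finite (S :: rat set)"
  shows "\<exists>D::int. D > 0 \<and> (\<forall>x\<in>S. of_int D * x \<in> \<int>)"
  using assms
proof induction
  case empty
  show ?case by (intro exI[of _ 1]) simp
next
  case (insert x S)
  then obtain D where D: "D > 0" "\<And>y. y \<in> S \<Longrightarrow> of_int D * y \<in> \<int>"
    by blast
  obtain a b where ab: "x = of_int a / of_int b" "b > 0"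
    by (metis quotient_of_denom_pos quotient_of_div surj_pair)
  have "of_int (b * D) * y \<in> \<int>" if "y \<in> insert x S" for y
  proof (cases "y = x")
    case True
    then have "of_int (b * D) * y = of_int (D * a)"
      using ab by simp
    then show ?thesis
      by (metis Ints_of_int)
  next
    case False
    then have "of_int (b * D) * y = of_int b * (of_int D * y)"
      by simp
    then show ?thesis
      using D(2)[of y] that False by (metis Ints_mult Ints_of_int insertE)
  qed
  then show ?case
    using D(1) ab(2) by (intro exI[of _ "b * D"]) auto
qed

text \<open>The coefficients of \<open>f\<close> are rational, so the relation \<open>q f = p\<close> stays true when a \<open>\<rat>\<close>-linear functional
is applied to all coefficients of \<open>p\<close> and \<open>q\<close>. It is chosen with value \<open>1\<close> at the leading
coefficient of \<open>q\<close>, so that the new denominator is not zero; then denominators are cleared.\<close>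

lemma rational_fps_descent:
  fixes f :: "complex fps"
  assumes "rational_fps f" and f: "\<And>n. f $ n \<in> \<rat>"
  shows "\<exists>P Q :: int poly. Q \<noteq> 0 \<and> complex_fps (fps_of_poly Q) * f = complex_fps (fps_of_poly P)"
proof -
  obtain p q where q: "q \<noteq> 0" and pq: "fps_of_poly q * f = fps_of_poly p"
    using assms(1) by (auto simp: rational_fps_def)
  obtain L :: "complex \<Rightarrow> rat" where L1: "L (lead_coeff q) = 1"
    and L_add: "\<And>x y. L (x + y) = L x + L y"
    and L_scale: "\<And>r x. L (of_rat r * x) = r * L x"
    using exists_rat_linear_functional[of "lead_coeff q"] q by auto
  have L0: "L 0 = 0"
    using L_scale[of 0 0] by simp
  have L_sum: "L (sum g S) = (\<Sum>i\<in>S. L (g i))" for g and S :: "nat set"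
    by (induction S rule: infinite_finite_induct) (simp_all add: L0 L_add)
  obtain D :: int where D: "D > 0"
    and D_int: "\<And>x. x \<in> L ` (set (coeffs p) \<union> set (coeffs q)) \<Longrightarrow> of_int D * x \<in> \<int>"
    using common_denominator[of "L ` (set (coeffs p) \<union> set (coeffs q))"] by auto
  have int: "of_int D * L (coeff h n) \<in> \<int>" if "h = p \<or> h = q" for h n
  proof (cases "coeff h n = 0")
    case False
    then have "coeff h n \<in> set (coeffs h)"
      using range_coeff[of h] by (metis insertE rangeI)
    then show ?thesis
      using that D_int by blast
  qed (simp add: L0)
  \<comment> \<open>The functional scaled by \<open>D\<close>; on the coefficients of \<open>p\<close> and \<open>q\<close> its values
    are integers, so rounding changes nothing there.\<close>
  define \<Lambda> where "\<Lambda> x = \<lfloor>of_int D * L x\<rfloor>" for x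
  have \<Lambda>0: "\<Lambda> 0 = 0"
    by (simp add: \<Lambda>_def L0)
  have \<Lambda>: "(of_int (\<Lambda> (coeff h n)) :: complex) = of_rat (of_int D * L (coeff h n))"
    if "h = p \<or> h = q" for h n
    using int[OF that, of n] by (auto simp: \<Lambda>_def elim!: Ints_cases)
  define P where "P = map_poly \<Lambda> p"
  define Q where "Q = map_poly \<Lambda> q"
  have "coeff Q (degree q) = D"
    by (simp add: Q_def coeff_map_poly \<Lambda>0) (simp add: \<Lambda>_def L1)
  then have "Q \<noteq> 0"
    using D by auto
  moreover have "complex_fps (fps_of_poly Q) * f = complex_fps (fps_of_poly P)"
  proof (rule fps_ext)
    fix n
    have "(complex_fps (fps_of_poly Q) * f) $ n = (\<Sum>i=0..n. of_rat (of_int D * L (coeff q i)) * f $ (n - i))"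
      by (simp add: fps_mult_nth Q_def coeff_map_poly \<Lambda>0 \<Lambda>)
    also have "\<dots> = (\<Sum>i=0..n. of_rat (of_int D * L (coeff q i * f $ (n - i))))"
    proof (intro sum.cong refl)
      fix i
      obtain s where s: "f $ (n - i) = of_rat s"
        using f[of "n - i"] by (auto elim: Rats_cases)
      have "L (coeff q i * f $ (n - i)) = s * L (coeff q i)"
        unfolding s by (metis L_scale mult.commute)
      then show "of_rat (of_int D * L (coeff q i)) * f $ (n - i) =
                 of_rat (of_int D * L (coeff q i * f $ (n - i)))"
        by (simp add: s of_rat_mult)
    qed
    also have "\<dots> = of_rat (of_int D * L ((fps_of_poly q * f) $ n))"
      by (simp add: fps_mult_nth L_sum sum_distrib_left of_rat_sum)
    also have "\<dots> = complex_fps (fps_of_poly P) $ n"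
      by (simp add: pq P_def coeff_map_poly \<Lambda>0 \<Lambda>)
    finally show "(complex_fps (fps_of_poly Q) * f) $ n = complex_fps (fps_of_poly P) $ n" .
  qed
  ultimately show ?thesis
    by blast
qed

section \<open>Integrality of rational exponentials\<close>

lemma log_deriv_imp_Rats:
  fixes f :: "complex fps"
  assumes "f $ 0 = 1" "log_deriv (complex_fps A) f" "A $ 0 = 0"
  shows "f $ n \<in> \<rat>"
proof (induction n rule: less_induct)
  case (less n)
  show ?case
  proof (cases "n = 0")
    case True
    then show ?thesis
      using assms(1) by simp
  next
    case False
    have "of_nat n * f $ n = (fps_X * fps_deriv f) $ n"
      using False by simp
    also have "\<dots> = (\<Sum>i=0..n. of_int (A $ i) * f $ (n - i))"
      using assms(2) by (simp add: log_deriv_def fps_mult_nth)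
    also have "\<dots> \<in> \<rat>"
    proof (intro Rats_sum)
      fix i show "of_int (A $ i) * f $ (n - i) \<in> \<rat>"
        using less[of "n - i"] assms(3) False by (cases "i = 0") auto
    qed
    finally have "of_nat n * f $ n / of_nat n \<in> \<rat>"
      by (intro Rats_divide) auto
    then show ?thesis
      using False by simp
  qed
qed

lemma integral_of_unit_denominator:
  fixes f :: "complex fps" and Q :: "int fps"
  assumes "is_unit (Q $ 0)" and eq: "complex_fps Q * f = complex_fps P"
  shows "\<exists>F. f = complex_fps F"
proof -
  have "f $ n \<in> \<int>" for n
  proof (induction n rule: less_induct)
    case (less n)
    have "of_int (P $ n) = (complex_fps Q * f) $ n"
      using eq by simp
    also have "\<dots> = of_int (Q $ 0) * f $ n + (\<Sum>i=1..n. of_int (Q $ i) * f $ (n - i))"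
      by (simp add: fps_mult_nth sum.atLeast_Suc_atMost)
    finally have "of_int (Q $ 0) * f $ n =
        of_int (P $ n) - (\<Sum>i=1..n. of_int (Q $ i) * f $ (n - i))"
      by simp
    also have "\<dots> \<in> \<int>"
      using less by (intro Ints_diff Ints_sum Ints_mult) auto
    finally have "of_int (Q $ 0) * f $ n \<in> \<int>" .
    moreover have "Q $ 0 = 1 \<or> Q $ 0 = -1"
      using assms(1) by (simp add: zdvd1_eq abs_eq_iff) (metis abs_eq_iff abs_one)
    ultimately show ?case
      by (auto simp: minus_in_Ints_iff)
  qed
  then have "f = complex_fps (Abs_fps (\<lambda>n. \<lfloor>Re (f $ n)\<rfloor>))"
    by (intro fps_ext) (metis Ints_cases Re_complex_of_real complex_fps_nth fps_nth_Abs_fps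
        floor_of_int of_real_of_int_eq)
  then show ?thesis
    by blast
qed

text \<open>Write \<open>f = P / Q\<close> with coprime integer polynomials. As \<open>f $ 0 = 1\<close>, they have the same constant
coefficient. It divides the contents of both \<open>P\<close> and \<open>Q\<close>, hence both polynomials, so it is a unit;
and the quotient of integer series by one with constant coefficient \<open>\<plusminus>1\<close> has integer coefficients.\<close>

theorem rational_fps_integral_of_log_deriv:
  fixes f :: "complex fps" and A :: "int fps"
  assumes f0: "f $ 0 = 1" and fA: "log_deriv (complex_fps A) f" and "rational_fps f"
  shows "\<exists>F. f = complex_fps F"
proof -
  have "A $ 0 = 0"
    using arg_cong[OF fA[unfolded log_deriv_def], of "\<lambda>h. h $ 0"] f0 by simp
  then have "f $ n \<in> \<rat>" for n
    using log_deriv_imp_Rats[OF f0 fA] by blast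
  then obtain P0 Q0 :: "int poly" where Q0: "Q0 \<noteq> 0"
    and PQ0: "complex_fps (fps_of_poly Q0) * f = complex_fps (fps_of_poly P0)"
    using rational_fps_descent[OF assms(3)] by blast
  obtain P Q where PQ: "P0 = P * gcd P0 Q0" "Q0 = Q * gcd P0 Q0" "coprime P Q"
    using gcd_coprime_exists[of P0 Q0] Q0 by auto
  define C where "C h = complex_fps (fps_of_poly h)" for h :: "int poly"
  have C_mult: "C (g * h) = C g * C h" for g h
    by (simp add: C_def fps_of_poly_mult complex_fps_mult)
  have C_inj: "C g = C h \<longleftrightarrow> g = h" for g h
    by (simp add: C_def complex_fps_inject fps_of_poly_eq_iff)
  have C0: "C 0 = 0"
    by (rule fps_ext) (simp add: C_def)
  have C_deriv: "C (pderiv h) = fps_deriv (C h)" for h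
    by (simp add: C_def fps_of_poly_pderiv complex_fps_deriv)
  have "C (gcd P0 Q0) * (C Q * f) = C (gcd P0 Q0) * C P"
    using PQ0[folded C_def] PQ(1,2) C_mult by (metis mult.assoc mult.commute)
  moreover have "C (gcd P0 Q0) \<noteq> 0"
    using Q0 C_inj[of "gcd P0 Q0" 0] by (simp add: C0)
  ultimately have f: "C Q * f = C P"
    by simp
  have P0Q0: "coeff Q 0 = coeff P 0"
    using arg_cong[OF f, of "\<lambda>h. h $ 0"] f0 by (simp add: C_def)
  have nz: "coeff P 0 \<noteq> 0"
  proof
    assume "coeff P 0 = 0"
    then have "[:0, 1:] dvd P" "[:0, 1:] dvd Q"
      using P0Q0 by (simp_all add: poly_0_coeff_0 dvd_iff_poly_eq_0)
    then have "is_unit [:0, 1 :: int:]"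
      using PQ(3) by (rule coprime_common_divisor[rotated])
    then show False
      by (auto elim!: is_unit_polyE)
  qed
  have eq: "fps_X * fps_of_poly (pderiv P * Q - P * pderiv Q) = A * fps_of_poly (P * Q)"
  proof -
    have "fps_X * fps_deriv (C P) = C Q * (fps_X * fps_deriv f) + fps_X * fps_deriv (C Q) * f"
      unfolding f[symmetric] by (simp add: algebra_simps)
    also have "\<dots> = complex_fps A * C P + fps_X * fps_deriv (C Q) * f"
      using fA unfolding log_deriv_def f[symmetric] by (simp only:) (simp add: algebra_simps)
    finally have "C Q * (fps_X * fps_deriv (C P)) =
        C Q * (complex_fps A * C P + fps_X * fps_deriv (C Q) * f)"
      by simp
    also have "\<dots> = complex_fps A * (C P * C Q) + fps_X * fps_deriv (C Q) * (C Q * f)"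
      by (simp add: algebra_simps)
    also have "C Q * f = C P"
      by (rule f)
    finally have "fps_X * (fps_deriv (C P) * C Q - C P * fps_deriv (C Q)) = complex_fps A * (C P * C Q)"
      by (simp add: algebra_simps)
    then have "complex_fps (fps_X * fps_of_poly (pderiv P * Q - P * pderiv Q)) =
               complex_fps (A * fps_of_poly (P * Q))"
      by (simp add: complex_fps_mult complex_fps_diff complex_fps_X complex_fps_deriv C_def
          fps_of_poly_mult fps_of_poly_diff fps_of_poly_pderiv)
    then show ?thesis
      by (simp only: complex_fps_inject)
  qed
  have "coeff P 0 dvd content P"
    by (rule constant_coeff_dvd_content[OF eq PQ(3) nz])
  moreover have "coeff P 0 dvd content Q"
  proof -
    have "fps_X * fps_of_poly (pderiv Q * P - Q * pderiv P) = (- A) * fps_of_poly (Q * P)"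
      using eq by (simp add: fps_of_poly_mult fps_of_poly_diff algebra_simps)
    then show ?thesis
      using constant_coeff_dvd_content[of Q P "- A"] PQ(3) nz P0Q0 by (simp add: coprime_commute)
  qed
  ultimately have "[:coeff P 0:] dvd P" "[:coeff P 0:] dvd Q"
    by (simp_all add: const_poly_dvd_iff_dvd_content)
  then have "is_unit [:coeff P 0:]"
    using PQ(3) by (meson coprime_common_divisor)
  then have "is_unit (coeff Q 0)"
    by (simp add: P0Q0 is_unit_const_poly_iff)
  then show ?thesis
    using integral_of_unit_denominator[of "fps_of_poly Q" f "fps_of_poly P"] f by (simp add: C_def)
qed

section \<open>The Reidemeister coincidence zeta function\<close>

lemma reidemeister_zeta_nth_0: "reidemeister_zeta G \<phi> \<psi> $ 0 = 1"
  by (simp add: reidemeister_zeta_def)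

lemma log_deriv_reidemeister_zeta:
  "log_deriv (complex_fps (Abs_fps (\<lambda>k. if k = 0 then 0 else
     int (reidemeister_number G (\<phi> ^^ k) (\<psi> ^^ k))))) (reidemeister_zeta G \<phi> \<psi>)"
    (is "log_deriv (complex_fps ?A) _")
proof -
  define L :: "complex fps" where "L = Abs_fps (\<lambda>k.
    of_nat (reidemeister_number G (\<phi> ^^ k) (\<psi> ^^ k)) / of_nat k)"
  have zeta: "reidemeister_zeta G \<phi> \<psi> = fps_exp 1 oo L"
    by (simp add: reidemeister_zeta_def L_def)
  have "fps_X * fps_deriv L = complex_fps ?A"
    by (rule fps_ext) (simp add: L_def field_simps)
  moreover have "fps_deriv (fps_exp 1 oo L) = (fps_exp 1 oo L) * fps_deriv L"
    by (subst fps_compose_deriv) (simp_all add: L_def)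
  ultimately show ?thesis
    unfolding log_deriv_def zeta by (metis mult.assoc mult.commute)
qed

theorem theorem19:
  fixes G :: "('a, 'b) monoid_scheme" and \<phi> \<psi> :: "'a \<Rightarrow> 'a"
  assumes "group G" and "torsion_free_group G" and "nilpotent_group G" and "finite_pruefer_rank G"
    and "\<phi> \<in> hom G G" and "\<psi> \<in> hom G G"
    and "tame_pair G \<phi> \<psi>"
    and "rational_fps (reidemeister_zeta G \<phi> \<psi>)"
  shows "\<forall>n::nat. n \<ge> 1 \<longrightarrow>
    [(\<Sum>k | k dvd n. moebius_mu (n div k) * int (reidemeister_number G (\<phi> ^^ k) (\<psi> ^^ k))) = 0]
      (mod int n)"
proof (intro allI impI)
  fix n :: nat assume n: "n \<ge> 1"
  let ?R = "\<lambda>k. int (reidemeister_number G (\<phi> ^^ k) (\<psi> ^^ k))"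
  let ?A = "Abs_fps (\<lambda>k. if k = 0 then 0 else ?R k)"
  obtain F where F: "reidemeister_zeta G \<phi> \<psi> = complex_fps F"
    using rational_fps_integral_of_log_deriv[OF reidemeister_zeta_nth_0 log_deriv_reidemeister_zeta
        \<open>rational_fps (reidemeister_zeta G \<phi> \<psi>)\<close>] by blast
  have "F $ 0 = 1"
    using reidemeister_zeta_nth_0[of G \<phi> \<psi>] by (simp add: F)
  moreover have "log_deriv ?A F"
    using log_deriv_reidemeister_zeta[of G \<phi> \<psi>] unfolding F log_deriv_def
    by (metis complex_fps_X complex_fps_deriv complex_fps_inject complex_fps_mult)
  ultimately have "[(\<Sum>k | k dvd n. moebius_mu (n div k) * ?A $ k) = 0] (mod int n)"
    using n by (intro gauss_congruence_of_log_deriv) auto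
  also have "(\<Sum>k | k dvd n. moebius_mu (n div k) * ?A $ k) =
      (\<Sum>k | k dvd n. moebius_mu (n div k) * ?R k)"
    using n by (intro sum.cong) auto
  finally show "[(\<Sum>k | k dvd n. moebius_mu (n div k) * ?R k) = 0] (mod int n)" .
qed

end
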